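(* The optimal lower density of a covering of the plane by closed unit circular disks with the constraint that the centers of the disks form a lattice in $\mathbb R^2$ and each disk contains the centers of at least two other disks is $\frac{2\pi}{2+\sqrt3}$. That is, the infimum of the lower densities over all coverings of $\mathbb R^2$ by the closed unit disks centered at the points of a two-dimensional lattice $\Lambda\subset\mathbb R^2$ such that each disk contains the centers of at least two other disks equals $\frac{2\pi}{2+\sqrt 3}$. Moreover, this optimal lower density is achieved by some lattice covering satisfying the constraint.
   Context: A closed unit circular disk is a congruent copy of $\mathcal D=\{(x,y)\in\mathbb R^2: x^2+y^2\le 1\}$. A countable family $\mathscr F$ of closed unit disks is a covering of the plane if its union is $\mathbb R^2$. A two-dimensional lattice is a set $\Lambda=\{\alpha v_1+\beta v_2:(\alpha,\beta)\in\mathbb Z^2\}$ with $v_1,v_2\in\mathbb R^2$ linearly independent; a lattice covering is a covering whose family of disks consists of the unit disks centered at the points of a lattice (one disk for each lattice point). Let $\mathcal I=[-1,1]\times[-1,1]$, and for $\lambda>0$ let $\lambda\mathcal I=\{\lambda x:x\in\mathcal I\}$. Write $a(\cdot)$ for area. Let $N_\lambda$ be the number of disks in $\mathscr F$ that intersect the interior of $\lambda\mathcal I$, and $\gamma(\lambda,\mathscr F)=\frac{N_\lambda\cdot a(\mathcal D)}{a(\lambda\mathcal I)}$. The lower density of $\mathscr F$ is $\liminf_{\lambda\to\infty}\gamma(\lambda,\mathscr F)$. *)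

theory Defs
  imports "HOL-Analysis.Analysis"
begin

text \<open>The plane is \<^typ>\<open>real^2\<close>. A family of closed unit disks is a set of disks. A congruent copy
  of the unit disk is determined by its center, so a set of disks has one disk per center.\<close>

definition unit_disk :: "real^2 \<Rightarrow> (real^2) set" where
  "unit_disk c = cball c 1"

definition disk_covering :: "(real^2) set set \<Rightarrow> bool" where
  "disk_covering F \<longleftrightarrow> countable F \<and> F \<subseteq> range unit_disk \<and> \<Union>F = UNIV"

definition plane_lattice :: "(real^2) set \<Rightarrow> bool" where
  "plane_lattice L \<longleftrightarrow>
     (\<exists>v w. v \<noteq> w \<and> independent {v, w} \<and>
            L = {of_int a *\<^sub>R v + of_int b *\<^sub>R w | a b :: int. True})"

definition lattice_covering :: "(real^2) set set \<Rightarrow> bool" where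
  "lattice_covering F \<longleftrightarrow> disk_covering F \<and> (\<exists>L. plane_lattice L \<and> F = unit_disk ` L)"

definition contains_two_other_centers :: "(real^2) set set \<Rightarrow> bool" where
  "contains_two_other_centers F \<longleftrightarrow>
     (\<forall>D\<in>F. \<exists>p q. p \<noteq> q \<and>
        unit_disk p \<in> F - {D} \<and> unit_disk q \<in> F - {D} \<and> p \<in> D \<and> q \<in> D)"

definition square :: "real \<Rightarrow> (real^2) set" where
  "square l = (\<lambda>x. l *\<^sub>R x) ` {x. x $ 1 \<in> {-1..1} \<and> x $ 2 \<in> {-1..1}}"

text \<open>The number of disks is taken with respect to counting measure, so that it is \<open>\<infinity>\<close> rather than
  \<open>0\<close> when infinitely many disks meet the square; densities are therefore extended nonnegative
  reals.\<close>

definition disk_count :: "(real^2) set set \<Rightarrow> real \<Rightarrow> ennreal" where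
  "disk_count F l = emeasure (count_space UNIV) {D \<in> F. D \<inter> interior (square l) \<noteq> {}}"

definition density_in_square :: "(real^2) set set \<Rightarrow> real \<Rightarrow> ennreal" where
  "density_in_square F l =
     disk_count F l * emeasure lborel (unit_disk 0) / emeasure lborel (square l)"

definition lower_density :: "(real^2) set set \<Rightarrow> ennreal" where
  "lower_density F = Liminf at_top (density_in_square F)"

end

theory Submission
  imports Defs "HOL-Real_Asymp.Real_Asymp"
begin

text \<open>Two facts carry the proof.

  First, a lattice covering has the density one expects, \<open>pi\<close> divided by the determinant of the
  lattice (\<open>lower_density_lattice\<close>): the half-open fundamental parallelograms at the lattice points
  that count for the square of half-side \<open>l\<close> are disjoint, and their union lies between the squares
  of half-sides \<open>l - C\<close> and \<open>l + C\<close>, with \<open>C\<close> independent of \<open>l\<close>. So the problem is to find the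
  largest determinant.

  Second, under the constraint the determinant is at most \<open>1 + sqrt 3 / 2\<close>. The disk about the
  origin contains another lattice point, so there is a primitive lattice vector \<open>e\<close> of length
  \<open>r \<le> 1\<close>. The lattice splits into rows parallel to \<open>e\<close>, at distance \<open>h\<close> from each other, and the
  determinant is \<open>r * h\<close>. Halfway between two neighbours in a row, the disks of that row reach only
  the height \<open>sqrt (1 - r^2 / 4)\<close>, while those of the next row come down only to the height \<open>h - 1\<close>.
  If every point is covered, then \<open>h \<le> 1 + sqrt (1 - r^2 / 4)\<close> (\<open>covering_row_spacing\<close>), and
  \<open>r * (1 + sqrt (1 - r^2 / 4))\<close> is largest at \<open>r = 1\<close> (\<open>row_spacing_maximal\<close>).

  Equality forces \<open>r = 1\<close> and, with consecutive rows shifted by half a step, gives the lattice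
  generated by \<open>(1, 0)\<close> and \<open>(1/2, 1 + sqrt 3 / 2)\<close>. It does cover: it is triangulated by acute
  triangles of circumradius 1, and every point of such a triangle is within the circumradius of
  some vertex (\<open>opt_covering\<close>).\<close>

section \<open>Plane lattices and their determinants\<close>

definition cross :: "real^2 \<Rightarrow> real^2 \<Rightarrow> real" where
  "cross v w = v $ 1 * w $ 2 - v $ 2 * w $ 1"

definition lattice_of :: "real^2 \<Rightarrow> real^2 \<Rightarrow> (real^2) set" where
  "lattice_of v w = {of_int a *\<^sub>R v + of_int b *\<^sub>R w | a b :: int. True}"

lemma cross_lincomb_left: "cross (s *\<^sub>R v + t *\<^sub>R w) z = s * cross v z + t * cross w z"
  by (simp add: cross_def algebra_simps)

lemma cross_lincomb_right: "cross z (s *\<^sub>R v + t *\<^sub>R w) = s * cross z v + t * cross z w"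
  by (simp add: cross_def algebra_simps)

lemma cross_self [simp]: "cross v v = 0"
  by (simp add: cross_def)

text \<open>Cramer's rule.\<close>

lemma cross_coordinates:
  assumes "cross v w \<noteq> 0"
  shows "x = (cross x w / cross v w) *\<^sub>R v + (cross v x / cross v w) *\<^sub>R w"
proof -
  have "cross v w *\<^sub>R x = cross x w *\<^sub>R v + cross v x *\<^sub>R w"
    by (simp add: vec_eq_iff forall_2 cross_def algebra_simps)
  then have "(1 / cross v w) *\<^sub>R (cross v w *\<^sub>R x)
      = (1 / cross v w) *\<^sub>R (cross x w *\<^sub>R v + cross v x *\<^sub>R w)"
    by simp
  then show ?thesis
    using assms by (simp add: scaleR_add_right)
qed

lemma coordinates_unique:
  assumes "cross v w \<noteq> 0" "s *\<^sub>R v + t *\<^sub>R w = s' *\<^sub>R v + t' *\<^sub>R w"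
  shows "s = s'" "t = t'"
proof -
  have "cross (s *\<^sub>R v + t *\<^sub>R w) w = cross (s' *\<^sub>R v + t' *\<^sub>R w) w"
    "cross v (s *\<^sub>R v + t *\<^sub>R w) = cross v (s' *\<^sub>R v + t' *\<^sub>R w)"
    using assms(2) by simp_all
  then show "s = s'" "t = t'"
    using assms(1) by (simp_all add: cross_lincomb_left cross_lincomb_right)
qed

lemma independent_pair_iff_cross:
  "v \<noteq> w \<and> independent {v, w} \<longleftrightarrow> cross v w \<noteq> 0"
proof
  assume vw: "v \<noteq> w \<and> independent {v, w}"
  then have w0: "w \<noteq> 0" and nspan: "v \<notin> range (\<lambda>k. k *\<^sub>R w)"
    by (auto simp: independent_insert span_singleton dependent_zero)
  show "cross v w \<noteq> 0"
  proof
    assume c: "cross v w = 0"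
    have "(w $ 1)\<^sup>2 + (w $ 2)\<^sup>2 \<noteq> 0"
      using w0 by (simp add: vec_eq_iff forall_2 sum_power2_eq_zero_iff)
    \<comment> \<open>When \<open>v\<close> and \<open>w\<close> are parallel, \<open>v\<close> equals its orthogonal projection onto \<open>w\<close>.\<close>
    moreover have "((w $ 1)\<^sup>2 + (w $ 2)\<^sup>2) *\<^sub>R v = (v $ 1 * w $ 1 + v $ 2 * w $ 2) *\<^sub>R w"
      using c unfolding cross_def vec_eq_iff forall_2 vector_scaleR_component real_scaleR_def
      by algebra
    ultimately have "v = ((v $ 1 * w $ 1 + v $ 2 * w $ 2) / ((w $ 1)\<^sup>2 + (w $ 2)\<^sup>2)) *\<^sub>R w"
      by (metis eq_vector_fraction_iff)
    then show False using nspan by blast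
  qed
next
  assume c: "cross v w \<noteq> 0"
  then have "w \<noteq> 0" "v \<noteq> w" by (auto simp: cross_def)
  moreover have "v \<notin> range (\<lambda>k. k *\<^sub>R w)"
    using c by (auto simp: cross_def)
  ultimately show "v \<noteq> w \<and> independent {v, w}"
    by (auto simp: independent_insert span_singleton)
qed

lemma plane_lattice_iff: "plane_lattice L \<longleftrightarrow> (\<exists>v w. cross v w \<noteq> 0 \<and> L = lattice_of v w)"
  unfolding plane_lattice_def lattice_of_def
  by (simp only: conj_assoc[symmetric] independent_pair_iff_cross)

lemma countable_lattice: "countable (lattice_of v w)"
proof -
  have "lattice_of v w = (\<lambda>(a, b). of_int a *\<^sub>R v + of_int b *\<^sub>R w) ` (UNIV :: (int \<times> int) set)"
    by (auto simp: lattice_of_def image_iff)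
  then show ?thesis by simp
qed

lemma zero_in_lattice: "0 \<in> lattice_of v w"
  unfolding lattice_of_def by (rule CollectI, rule exI[of _ 0], rule exI[of _ 0]) simp

lemma lattice_add:
  assumes "p \<in> lattice_of v w" "q \<in> lattice_of v w"
  shows "p + q \<in> lattice_of v w"
proof -
  obtain a b a' b' :: int where
    "p = of_int a *\<^sub>R v + of_int b *\<^sub>R w" "q = of_int a' *\<^sub>R v + of_int b' *\<^sub>R w"
    using assms unfolding lattice_of_def by blast
  then have "p + q = of_int (a + a') *\<^sub>R v + of_int (b + b') *\<^sub>R w"
    by (simp add: algebra_simps)
  then show ?thesis unfolding lattice_of_def by blast
qed

lemma unit_disk_eq_iff [simp]: "unit_disk p = unit_disk q \<longleftrightarrow> p = q"
  by (simp add: unit_disk_def cball_eq_cball_iff)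

lemma lattice_covering_iff:
  "lattice_covering F \<longleftrightarrow>
     (\<exists>v w. cross v w \<noteq> 0 \<and> F = unit_disk ` lattice_of v w \<and> (\<forall>x. \<exists>q\<in>lattice_of v w. dist q x \<le> 1))"
proof -
  have "\<Union> (unit_disk ` L) = UNIV \<longleftrightarrow> (\<forall>x. \<exists>q\<in>L. dist q x \<le> 1)" for L
    unfolding unit_disk_def by (simp add: set_eq_iff)
  then show ?thesis
    unfolding lattice_covering_def disk_covering_def plane_lattice_iff
    by (smt (verit, best) countable_image countable_lattice image_mono subset_UNIV)
qed

section \<open>The density of a lattice of disks\<close>

text \<open>The parallelogram is half-open, so that its lattice translates partition the plane exactly
  and no null sets have to be discarded when areas are added.\<close>

definition fundamental_cell :: "real^2 \<Rightarrow> real^2 \<Rightarrow> (real^2) set" where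
  "fundamental_cell v w = (\<lambda>x :: real^2. x $ 1 *\<^sub>R v + x $ 2 *\<^sub>R w) ` {x. \<forall>i. 0 \<le> x $ i \<and> x $ i < 1}"

lemma cell_iff: "x \<in> fundamental_cell v w \<longleftrightarrow>
   (\<exists>s t. 0 \<le> s \<and> s < 1 \<and> 0 \<le> t \<and> t < 1 \<and> x = s *\<^sub>R v + t *\<^sub>R w)" (is "_ \<longleftrightarrow> ?R")
proof
  assume "x \<in> fundamental_cell v w"
  then show ?R by (auto simp: fundamental_cell_def forall_2)
next
  assume ?R
  then obtain s t where st: "0 \<le> s" "s < 1" "0 \<le> t" "t < 1" "x = s *\<^sub>R v + t *\<^sub>R w" by blast
  show "x \<in> fundamental_cell v w"
    unfolding fundamental_cell_def
    by (rule image_eqI[of _ _ "vector [s, t] :: real^2"]) (use st in \<open>auto simp: forall_2 vector_2\<close>)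
qed

lemma lmeasurable_cell: "fundamental_cell v w \<in> lmeasurable"
  and measure_cell: "measure lebesgue (fundamental_cell v w) = \<bar>cross v w\<bar>"
proof -
  let ?f = "\<lambda>x :: real^2. x $ 1 *\<^sub>R v + x $ 2 *\<^sub>R w"
  let ?Q = "{x :: real^2. \<forall>i. 0 \<le> x $ i \<and> x $ i < 1}"
  have lin: "linear ?f"
    by (rule linearI) (simp_all add: algebra_simps)
  \<comment> \<open>The half-open square is squeezed between the open and the closed one, both of area 1.\<close>
  have sub: "box 0 1 \<subseteq> ?Q" "?Q \<subseteq> cbox 0 1"
    by (auto simp: mem_box_cart less_imp_le)
  have "?Q \<in> sets borel"
    by measurable
  then have Q: "?Q \<in> lmeasurable"
    using bounded_subset[OF bounded_cbox sub(2)]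
    by (intro bounded_set_imp_lmeasurable) auto
  have "measure lborel (cbox 0 1 :: (real^2) set) = 1"
    by (subst content_cbox_if_cart) (auto simp: interval_eq_empty_cart UNIV_2)
  then have 1: "measure lebesgue (cbox 0 1 :: (real^2) set) = 1"
    "measure lebesgue (box 0 1 :: (real^2) set) = 1"
    by (simp_all add: measure_lborel_box_eq measure_lborel_cbox_eq)
  have "measure lebesgue (box 0 1 :: (real^2) set) \<le> measure lebesgue ?Q"
    by (rule measure_mono_fmeasurable[OF sub(1) _ Q]) simp
  moreover have "measure lebesgue ?Q \<le> measure lebesgue (cbox 0 1 :: (real^2) set)"
    by (rule measure_mono_fmeasurable[OF sub(2) fmeasurableD[OF Q]]) simp
  ultimately have "measure lebesgue ?Q = 1"
    unfolding 1 by linarith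
  then show "fundamental_cell v w \<in> lmeasurable" "measure lebesgue (fundamental_cell v w) = \<bar>cross v w\<bar>"
    using measurable_linear_image[OF lin Q] measure_linear_image[OF lin Q]
    by (simp_all add: fundamental_cell_def matrix_def det_2 axis_def cross_def mult.commute)
qed

lemma cell_norm_bound:
  assumes "x \<in> fundamental_cell v w"
  shows "norm x \<le> norm v + norm w"
proof -
  obtain s t where st: "0 \<le> s" "s < 1" "0 \<le> t" "t < 1" "x = s *\<^sub>R v + t *\<^sub>R w"
    using assms by (auto simp: cell_iff)
  have "norm x \<le> s * norm v + t * norm w"
    using norm_triangle_ineq[of "s *\<^sub>R v" "t *\<^sub>R w"] st by simp
  also have "\<dots> \<le> 1 * norm v + 1 * norm w"
    using st by (intro add_mono mult_right_mono) auto
  finally show ?thesis by simp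
qed

text \<open>Rounding both coordinates down gives the lattice point; the fractional parts give the place
  in the cell.\<close>

lemma cells_cover_plane:
  assumes "cross v w \<noteq> 0"
  obtains q where "q \<in> lattice_of v w" "x - q \<in> fundamental_cell v w"
proof -
  define s t where "s = cross x w / cross v w" and "t = cross v x / cross v w"
  let ?q = "of_int \<lfloor>s\<rfloor> *\<^sub>R v + of_int \<lfloor>t\<rfloor> *\<^sub>R w"
  have "x = s *\<^sub>R v + t *\<^sub>R w"
    using cross_coordinates[OF assms] by (simp add: s_def t_def)
  then have "x - ?q = frac s *\<^sub>R v + frac t *\<^sub>R w"
    by (simp add: frac_def algebra_simps)
  then have "x - ?q \<in> fundamental_cell v w"
    unfolding cell_iff using frac_ge_0 frac_lt_1 by blast
  moreover have "?q \<in> lattice_of v w" unfolding lattice_of_def by blast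
  ultimately show ?thesis using that by blast
qed

lemma cells_disjoint:
  assumes "cross v w \<noteq> 0"
  shows "disjoint_family_on (\<lambda>q. (+) q ` fundamental_cell v w) (lattice_of v w)"
  unfolding disjoint_family_on_def
proof (intro ballI impI equals0I)
  fix p q x
  assume "p \<in> lattice_of v w" "q \<in> lattice_of v w" "p \<noteq> q"
    and x: "x \<in> (+) p ` fundamental_cell v w \<inter> (+) q ` fundamental_cell v w"
  then obtain a b a' b' :: int where
    p: "p = of_int a *\<^sub>R v + of_int b *\<^sub>R w" and q: "q = of_int a' *\<^sub>R v + of_int b' *\<^sub>R w"
    unfolding lattice_of_def by blast
  obtain s t s' t' where st: "0 \<le> s" "s < 1" "0 \<le> t" "t < 1" "x = p + (s *\<^sub>R v + t *\<^sub>R w)"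
    and st': "0 \<le> s'" "s' < 1" "0 \<le> t'" "t' < 1" "x = q + (s' *\<^sub>R v + t' *\<^sub>R w)"
    using x by (auto simp: cell_iff)
  have "(of_int a + s) *\<^sub>R v + (of_int b + t) *\<^sub>R w = (of_int a' + s') *\<^sub>R v + (of_int b' + t') *\<^sub>R w"
    using st(5) st'(5) p q by (simp add: algebra_simps)
  note coordinates_unique[OF assms this]
  then have "a = a'" "b = b'"
    using st st' by linarith+
  with \<open>p \<noteq> q\<close> show False by (simp add: p q)
qed

lemma square_eq:
  assumes "l > 0"
  shows "square l = cbox (vec (- l)) (vec l)"
proof -
  have "x \<in> square l \<longleftrightarrow> x \<in> cbox (vec (- l)) (vec l)" for x
  proof -
    have "x = l *\<^sub>R y \<longleftrightarrow> y = (1 / l) *\<^sub>R x" for y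
      using assms by auto
    then have "x \<in> square l \<longleftrightarrow> (1 / l) *\<^sub>R x \<in> {x. x $ 1 \<in> {-1..1} \<and> x $ 2 \<in> {-1..1}}"
      unfolding square_def image_iff by simp
    then show ?thesis
      using assms by (auto simp: mem_box_cart forall_2 field_simps)
  qed
  then show ?thesis by blast
qed

lemma mem_square:
  assumes "l > 0"
  shows "x \<in> square l \<longleftrightarrow> (\<forall>i. \<bar>x $ i\<bar> \<le> l)"
proof -
  have "\<bar>y\<bar> \<le> l \<longleftrightarrow> - l \<le> y \<and> y \<le> l" for y by linarith
  then show ?thesis using assms by (simp add: square_eq mem_box_cart)
qed

lemma mem_interior_square:
  assumes "l > 0"
  shows "x \<in> interior (square l) \<longleftrightarrow> (\<forall>i. \<bar>x $ i\<bar> < l)"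
proof -
  have "\<bar>y\<bar> < l \<longleftrightarrow> - l < y \<and> y < l" for y by linarith
  then show ?thesis using assms by (simp add: square_eq interior_cbox mem_box_cart)
qed

lemma emeasure_square: "l > 0 \<Longrightarrow> emeasure lborel (square l) = ennreal (4 * l\<^sup>2)"
proof -
  assume l: "l > 0"
  have "measure lborel (square l) = 4 * l\<^sup>2"
    using l unfolding square_eq[OF l]
    by (subst content_cbox_if_cart)
      (auto simp: interval_eq_empty_cart UNIV_2 power2_eq_square not_less)
  then show ?thesis
    unfolding square_eq[OF l] by (metis emeasure_eq_ennreal_measure emeasure_lborel_cbox_finite
        infinity_ennreal_def less_irrefl)
qed

definition meeting_centers :: "(real^2) set \<Rightarrow> real \<Rightarrow> (real^2) set" where
  "meeting_centers L l = {q \<in> L. unit_disk q \<inter> interior (square l) \<noteq> {}}"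

lemma disk_count_eq:
  "disk_count (unit_disk ` L) l = emeasure (count_space UNIV) (meeting_centers L l)"
proof -
  have eq: "{D \<in> unit_disk ` L. D \<inter> interior (square l) \<noteq> {}} = unit_disk ` meeting_centers L l"
    by (auto simp: meeting_centers_def)
  have inj: "inj_on unit_disk A" for A
    by (simp add: inj_on_def)
  show ?thesis
    unfolding disk_count_def eq by (simp add: emeasure_count_space finite_image_iff inj card_image)
qed

text \<open>Countable additivity, as an integral over the counting measure, turns the number of lattice
  points, finite or infinite, into an area.\<close>

lemma emeasure_union_cells:
  assumes "cross v w \<noteq> 0" "A \<subseteq> lattice_of v w"
  shows "emeasure lebesgue (\<Union>q\<in>A. (+) q ` fundamental_cell v w)
           = ennreal \<bar>cross v w\<bar> * emeasure (count_space UNIV) A"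
proof -
  have m: "(+) q ` fundamental_cell v w \<in> lmeasurable" for q
    by (simp add: lmeasurable_cell measurable_translation)
  have e: "emeasure lebesgue ((+) q ` fundamental_cell v w) = ennreal \<bar>cross v w\<bar>" for q
    using emeasure_eq_measure2[OF m[of q]] by (simp add: measure_translation measure_cell)
  have "emeasure lebesgue (\<Union>q\<in>A. (+) q ` fundamental_cell v w)
      = (\<integral>\<^sup>+q. emeasure lebesgue ((+) q ` fundamental_cell v w) \<partial>count_space A)"
    using m countable_subset[OF assms(2) countable_lattice]
      disjoint_family_on_mono[OF assms(2) cells_disjoint[OF assms(1)]]
    by (intro emeasure_UN_countable) (auto simp: fmeasurableD)
  also have "\<dots> = ennreal \<bar>cross v w\<bar> * emeasure (count_space A) A"
    by (simp add: e)
  finally show ?thesis by (simp add: emeasure_count_space)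
qed

text \<open>A disk meets the open square when its center lies in it, and a center whose disk meets the
  open square is within 1 of it. A cell at a center extends at most \<open>norm v + norm w\<close> from it. So
  the cells at the counted centers fill the square of half-side \<open>l - C\<close> and stay inside the one of
  half-side \<open>l + C\<close>; the summand 1 in \<open>C\<close> pays for the radius in the outer inclusion, and for
  strictness (the interior of the square) in the inner one. In particular the count is finite.\<close>

lemma disk_count_bounds:
  fixes v w :: "real^2"
  defines "C \<equiv> norm v + norm w + 1"
  assumes c: "cross v w \<noteq> 0" and l: "l > C"
  obtains n where "0 \<le> n" "disk_count (unit_disk ` lattice_of v w) l = ennreal n"
    "4 * (l - C)\<^sup>2 \<le> n * \<bar>cross v w\<bar>" "n * \<bar>cross v w\<bar> \<le> 4 * (l + C)\<^sup>2"
proof -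
  let ?A = "meeting_centers (lattice_of v w) l"
  let ?U = "\<Union>q\<in>?A. (+) q ` fundamental_cell v w"
  have pos: "C > 0" "l > 0" "l - C > 0" "l + C > 0"
    using l unfolding C_def by (smt (verit) norm_ge_zero)+
  have sub: "?A \<subseteq> lattice_of v w" by (auto simp: meeting_centers_def)
  have U: "emeasure lebesgue ?U = ennreal \<bar>cross v w\<bar> * disk_count (unit_disk ` lattice_of v w) l"
    using emeasure_union_cells[OF c sub] by (simp add: disk_count_eq)
  have Usets: "?U \<in> sets lebesgue"
    using countable_subset[OF sub countable_lattice]
    by (intro sets.countable_UN') (auto simp: fmeasurableD lmeasurable_cell measurable_translation)
  have inner: "square (l - C) \<subseteq> ?U"
  proof
    fix x assume x: "x \<in> square (l - C)"
    obtain q where q: "q \<in> lattice_of v w" "x - q \<in> fundamental_cell v w"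
      using cells_cover_plane[OF c] by blast
    have "\<bar>q $ i\<bar> < l" for i
    proof -
      have "\<bar>x $ i\<bar> \<le> l - C" using x mem_square[OF pos(3)] by blast
      moreover have "\<bar>(x - q) $ i\<bar> \<le> norm v + norm w"
        using component_le_norm_cart cell_norm_bound[OF q(2)] order_trans by blast
      ultimately show ?thesis by (simp add: C_def)
    qed
    then have "q \<in> interior (square l)" using mem_interior_square[OF pos(2)] by blast
    moreover have "q \<in> unit_disk q" by (simp add: unit_disk_def)
    ultimately have "q \<in> ?A" using q(1) by (auto simp: meeting_centers_def)
    moreover have "x \<in> (+) q ` fundamental_cell v w" using q(2) by (auto simp: image_iff intro!: bexI[of _ "x - q"])
    ultimately show "x \<in> ?U" by blast
  qed
  have outer: "?U \<subseteq> square (l + C)"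
  proof
    fix x assume "x \<in> ?U"
    then obtain q z where q: "q \<in> ?A" "z \<in> fundamental_cell v w" "x = q + z" by blast
    then obtain y where y: "dist q y \<le> 1" "y \<in> interior (square l)"
      by (auto simp: meeting_centers_def unit_disk_def)
    have "\<bar>x $ i\<bar> \<le> l + C" for i
    proof -
      have "\<bar>y $ i\<bar> < l" using y(2) mem_interior_square[OF pos(2)] by blast
      moreover have "\<bar>(q - y) $ i\<bar> \<le> 1"
        using component_le_norm_cart y(1) order_trans unfolding dist_norm by blast
      moreover have "\<bar>z $ i\<bar> \<le> norm v + norm w"
        using component_le_norm_cart cell_norm_bound[OF q(2)] order_trans by blast
      ultimately show ?thesis by (simp add: C_def q(3))
    qed
    then show "x \<in> square (l + C)" using mem_square[OF pos(4)] by blast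
  qed
  have sq: "emeasure lebesgue (square r) = ennreal (4 * r\<^sup>2)" "square r \<in> sets lebesgue" if "r > 0" for r
    using emeasure_square[OF that] by (simp_all add: square_eq[OF that])
  have lower: "ennreal (4 * (l - C)\<^sup>2) \<le> ennreal \<bar>cross v w\<bar> * disk_count (unit_disk ` lattice_of v w) l"
    using emeasure_mono[OF inner Usets] unfolding sq(1)[OF pos(3)] U .
  have upper: "ennreal \<bar>cross v w\<bar> * disk_count (unit_disk ` lattice_of v w) l \<le> ennreal (4 * (l + C)\<^sup>2)"
    using emeasure_mono[OF outer sq(2)[OF pos(4)]] unfolding sq(1)[OF pos(4)] U .
  show ?thesis
  proof (cases "disk_count (unit_disk ` lattice_of v w) l")
    case (real n)
    then show ?thesis
      using that lower upper by (simp add: ennreal_mult[symmetric] mult.commute)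
  next
    case top
    then show ?thesis
      using upper c by (simp add: ennreal_mult_top top_unique)
  qed
qed

text \<open>The boundary layer of width \<open>C\<close> is negligible as \<open>l\<close> grows, so the density in squares even
  converges, and its lower limit is the reciprocal of the cell area times the area of a disk.\<close>

lemma lower_density_lattice:
  assumes c: "cross v w \<noteq> 0"
  shows "lower_density (unit_disk ` lattice_of v w) = ennreal (pi / \<bar>cross v w\<bar>)"
proof -
  let ?F = "unit_disk ` lattice_of v w"
  define C where "C = norm v + norm w + 1"
  define d where "d = \<bar>cross v w\<bar>"
  define \<rho> where "\<rho> l = enn2real (disk_count ?F l) * pi / (4 * l\<^sup>2)" for l
  have d: "d > 0" using c by (simp add: d_def)
  have C: "C > 0" unfolding C_def by (smt (verit) norm_ge_zero)
  have bounds: "density_in_square ?F l = ennreal (\<rho> l)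
      \<and> pi / d * ((l - C) / l)\<^sup>2 \<le> \<rho> l \<and> \<rho> l \<le> pi / d * ((l + C) / l)\<^sup>2" if l: "l > C" for l
  proof -
    obtain n where n: "0 \<le> n" "disk_count ?F l = ennreal n"
      "4 * (l - C)\<^sup>2 \<le> n * d" "n * d \<le> 4 * (l + C)\<^sup>2"
      using disk_count_bounds[OF c, of l] l unfolding C_def d_def by blast
    have l0: "l > 0" using C l by simp
    have \<rho>: "\<rho> l = n * pi / (4 * l\<^sup>2)" using n by (simp add: \<rho>_def)
    have "emeasure lborel (unit_disk 0) = ennreal pi"
      by (simp add: unit_disk_def emeasure_cball unit_ball_vol_2)
    then have "density_in_square ?F l = ennreal (\<rho> l)"
      using n l0 by (simp add: density_in_square_def emeasure_square \<rho> ennreal_mult[symmetric] divide_ennreal)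
    moreover have "pi / d * ((l - C) / l)\<^sup>2 = (4 * (l - C)\<^sup>2) * pi / (4 * l\<^sup>2 * d)"
      "pi / d * ((l + C) / l)\<^sup>2 = (4 * (l + C)\<^sup>2) * pi / (4 * l\<^sup>2 * d)"
      "\<rho> l = (n * d) * pi / (4 * l\<^sup>2 * d)"
      using d l0 by (simp_all add: \<rho> power_divide mult.commute)
    moreover have "(4 * (l - C)\<^sup>2) * pi / (4 * l\<^sup>2 * d) \<le> (n * d) * pi / (4 * l\<^sup>2 * d)"
      "(n * d) * pi / (4 * l\<^sup>2 * d) \<le> (4 * (l + C)\<^sup>2) * pi / (4 * l\<^sup>2 * d)"
      using n(3,4) d by (intro divide_right_mono mult_right_mono; simp)+
    ultimately show ?thesis by metis
  qed
  have lim: "((\<lambda>l. pi / d * ((l - C) / l)\<^sup>2) \<longlongrightarrow> pi / d) at_top"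
    "((\<lambda>l. pi / d * ((l + C) / l)\<^sup>2) \<longlongrightarrow> pi / d) at_top"
    by real_asymp+
  note large = eventually_mono[OF eventually_gt_at_top[of C]]
  have "(\<rho> \<longlongrightarrow> pi / d) at_top"
    by (rule tendsto_sandwich[OF large large lim]) (use bounds in blast)+
  then have "((\<lambda>l. ennreal (\<rho> l)) \<longlongrightarrow> ennreal (pi / d)) at_top"
    by (rule tendsto_ennrealI)
  then have "(density_in_square ?F \<longlongrightarrow> ennreal (pi / d)) at_top"
    by (rule Lim_transform_eventually[OF _ large]) (use bounds in simp)
  then show ?thesis
    unfolding lower_density_def d_def by (intro lim_imp_Liminf) auto
qed

section \<open>The determinant bound\<close>

lemma norm_sq_2: "(norm x)\<^sup>2 = (x $ 1)\<^sup>2 + (x $ 2)\<^sup>2" for x :: "real^2"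
  by (simp add: norm_vec_def L2_set_def sum_2)

text \<open>By Lagrange's identity the squares of the cross product and of the inner product add up to
  the product of the squared norms.\<close>

lemma abs_cross_le: "\<bar>cross u x\<bar> \<le> norm u * norm x"
proof (rule power2_le_imp_le)
  have "(cross u x)\<^sup>2 + (u $ 1 * x $ 1 + u $ 2 * x $ 2)\<^sup>2 = (norm u)\<^sup>2 * (norm x)\<^sup>2"
    unfolding norm_sq_2 cross_def by algebra
  then have "(cross u x)\<^sup>2 \<le> (norm u)\<^sup>2 * (norm x)\<^sup>2"
    using zero_le_power2[of "u $ 1 * x $ 1 + u $ 2 * x $ 2"] by linarith
  then show "\<bar>cross u x\<bar>\<^sup>2 \<le> (norm u * norm x)\<^sup>2"
    by (simp add: power_mult_distrib)
qed simp

text \<open>Dividing the coefficients by their greatest common divisor only shortens the vector.\<close>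

lemma primitive_direction:
  assumes "u \<in> lattice_of v w" "u \<noteq> 0"
  obtains a b :: int and e where "coprime a b" "e = of_int a *\<^sub>R v + of_int b *\<^sub>R w"
    "e \<noteq> 0" "norm e \<le> norm u"
proof -
  obtain a b :: int where u: "u = of_int a *\<^sub>R v + of_int b *\<^sub>R w"
    using assms(1) unfolding lattice_of_def by blast
  have ab: "a \<noteq> 0 \<or> b \<noteq> 0" using u assms(2) by auto
  define g where "g = gcd a b"
  have g: "g \<ge> 1" using ab unfolding g_def by (smt (verit) gcd_pos_int)
  obtain a' b' where a': "a = g * a'" and b': "b = g * b'"
    unfolding g_def by (meson dvdE gcd_dvd1 gcd_dvd2)
  have cop: "coprime a' b'"
    using div_gcd_coprime[OF ab] g a' b' unfolding g_def[symmetric] by simp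
  define e where "e = of_int a' *\<^sub>R v + of_int b' *\<^sub>R w"
  have ue: "u = of_int g *\<^sub>R e"
    unfolding u e_def a' b' by (simp add: scaleR_add_right)
  then have "e \<noteq> 0" using assms(2) by auto
  moreover have "norm e \<le> norm u"
    using g mult_right_mono[of 1 "real_of_int g" "norm e"] by (simp add: ue)
  ultimately show ?thesis using that cop e_def by blast
qed

text \<open>With a Bezout relation \<open>r * a + s * b = 1\<close>, the factor is \<open>r * x + s * y\<close>.\<close>

lemma coprime_proportional:
  fixes a b x y :: int
  assumes "coprime a b" "a * y = b * x"
  obtains k where "x = k * a" "y = k * b"
proof -
  obtain r s where rs: "r * a + s * b = 1"
    using bezout_int[of a b] assms(1) by auto
  have "x = (r * x + s * y) * a" "y = (r * x + s * y) * b"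
    using rs assms(2) by algebra+
  then show ?thesis using that by blast
qed

text \<open>The value of \<open>cross e q\<close> tells in which row parallel to \<open>e\<close> the lattice point \<open>q\<close> lies: it is an
  integer multiple of the determinant \<open>d\<close>, and it is 0 only for the multiples of \<open>e\<close> because the
  coefficients of \<open>e\<close> are coprime. If the bound fails, there is a height \<open>t\<close> with \<open>s < t < d / r - 1\<close>,
  where \<open>s = sqrt (1 - r^2 / 4)\<close>. The point at height \<open>t\<close> above \<open>e / 2\<close> is farther than 1 from every
  multiple of \<open>e\<close> because \<open>s < t\<close>, and farther than 1 from every other row because \<open>t < d / r - 1\<close>.\<close>

lemma covering_row_spacing:
  assumes cov: "\<forall>x. \<exists>q\<in>lattice_of v w. dist q x \<le> 1"
    and cop: "coprime a b" and e: "e = of_int a *\<^sub>R v + of_int b *\<^sub>R w" and e0: "e \<noteq> 0"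
    and e1: "norm e \<le> 1"
  shows "\<bar>cross v w\<bar> \<le> norm e * (1 + sqrt (1 - (norm e)\<^sup>2 / 4))"
proof (rule ccontr)
  define r d where "r = norm e" and "d = \<bar>cross v w\<bar>"
  define s where "s = sqrt (1 - r\<^sup>2 / 4)"
  assume "\<not> \<bar>cross v w\<bar> \<le> norm e * (1 + sqrt (1 - (norm e)\<^sup>2 / 4))"
  then have big: "d > r * (1 + s)" by (simp add: r_def d_def s_def)
  have r: "0 < r" "r \<le> 1" using e0 e1 by (simp_all add: r_def)
  have "r\<^sup>2 \<le> 1" using r by (simp add: power_le_one)
  then have s: "s \<ge> 0" "s\<^sup>2 = 1 - r\<^sup>2 / 4" by (simp_all add: s_def)
  have "s < d / r - 1" using big r by (simp add: field_simps)
  then obtain t where t: "s < t" "t < d / r - 1" using dense by blast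
  have td: "r * t + r < d" using t r by (simp add: field_simps)
  define n where "n = (vector [- e $ 2, e $ 1] :: real^2)"
  define p where "p = (1 / 2) *\<^sub>R e + (t / r) *\<^sub>R n"
  have n: "n $ 1 = - e $ 2" "n $ 2 = e $ 1" by (simp_all add: n_def vector_2)
  have r2: "(e $ 1)\<^sup>2 + (e $ 2)\<^sup>2 = r\<^sup>2" using norm_sq_2[of e] by (simp add: r_def)
  obtain q where q: "q \<in> lattice_of v w" "dist q p \<le> 1" using cov by blast
  obtain x y :: int where xy: "q = of_int x *\<^sub>R v + of_int y *\<^sub>R w"
    using q(1) unfolding lattice_of_def by blast
  define m where "m = a * y - b * x"
  have eq: "cross e q = of_int m * cross v w"
    unfolding e xy m_def by (simp add: cross_def algebra_simps)
  show False
  proof (cases "m = 0")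
    case False
    \<comment> \<open>Another row: the distance of \<open>q\<close> and \<open>p\<close> across the rows alone exceeds 1.\<close>
    have "cross e n = r\<^sup>2"
      using r2 by (simp add: cross_def n power2_eq_square)
    then have ep: "cross e p = r * t"
      using r by (simp add: p_def cross_lincomb_right power2_eq_square)
    have "1 * d \<le> \<bar>real_of_int m\<bar> * d"
      using False by (intro mult_right_mono) (auto simp: d_def)
    then have "d \<le> \<bar>cross e q\<bar>" by (simp add: eq d_def abs_mult)
    also have "cross e q = cross e (q - p) + r * t"
      using ep by (simp add: cross_def algebra_simps)
    also have "\<bar>\<dots>\<bar> \<le> \<bar>cross e (q - p)\<bar> + r * t"
      using mult_nonneg_nonneg[of r t] r s t by linarith
    also have "\<bar>cross e (q - p)\<bar> \<le> r * norm (q - p)"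
      unfolding r_def by (rule abs_cross_le)
    also have "\<dots> \<le> r * 1"
      using q(2) r by (intro mult_left_mono) (auto simp: dist_norm)
    finally show False using td by simp
  next
    case True
    \<comment> \<open>The row through the origin: the nearest of its points to \<open>p\<close> are \<open>0\<close> and \<open>e\<close>.\<close>
    then obtain k where "x = k * a" "y = k * b"
      using coprime_proportional[OF cop] unfolding m_def by auto
    then have qk: "q = of_int k *\<^sub>R e"
      unfolding xy e by (simp add: scaleR_add_right)
    let ?k = "real_of_int k - 1 / 2"
    have "(dist q p)\<^sup>2 = (?k * e $ 1 - (t / r) * n $ 1)\<^sup>2 + (?k * e $ 2 - (t / r) * n $ 2)\<^sup>2"
      unfolding dist_norm norm_sq_2 by (simp add: qk p_def algebra_simps)
    also have "\<dots> = (?k\<^sup>2 + (t / r)\<^sup>2) * ((e $ 1)\<^sup>2 + (e $ 2)\<^sup>2)"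
      unfolding n by algebra
    also have "\<dots> = ?k\<^sup>2 * r\<^sup>2 + t\<^sup>2"
      unfolding r2 using r by (simp add: power_divide distrib_right)
    finally have dist: "(dist q p)\<^sup>2 = ?k\<^sup>2 * r\<^sup>2 + t\<^sup>2" .
    have "k \<le> 0 \<or> k \<ge> 1" by linarith
    then have "real_of_int k \<le> 0 \<or> real_of_int k \<ge> 1" by simp
    then have "1 / 2 \<le> \<bar>?k\<bar>" by linarith
    then have "(1 / 2)\<^sup>2 \<le> ?k\<^sup>2" by (simp add: abs_le_square_iff[symmetric])
    then have "(1 / 2)\<^sup>2 * r\<^sup>2 \<le> ?k\<^sup>2 * r\<^sup>2" by (rule mult_right_mono) simp
    moreover have "s\<^sup>2 < t\<^sup>2" using s t by (intro power_strict_mono) auto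
    ultimately have "(dist q p)\<^sup>2 > 1" unfolding dist s(2) by (simp add: power_divide)
    moreover have "(dist q p)\<^sup>2 \<le> 1" using q(2) by (simp add: power_le_one)
    ultimately show False by simp
  qed
qed

text \<open>After the bound \<open>r \<le> 1\<close> on the first summand, the rest is \<open>(1 - r^2) * (3 - r^2) \<ge> 0\<close>.\<close>

lemma row_spacing_maximal:
  fixes r :: real
  assumes "0 \<le> r" "r \<le> 1"
  shows "r * (1 + sqrt (1 - r\<^sup>2 / 4)) \<le> 1 + sqrt 3 / 2"
proof -
  have r2: "r\<^sup>2 \<le> 1" using assms by (simp add: power_le_one)
  have "(r * sqrt (1 - r\<^sup>2 / 4))\<^sup>2 = r\<^sup>2 * (1 - r\<^sup>2 / 4)"
    using r2 by (simp add: power_mult_distrib)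
  also have "\<dots> = 3 / 4 - (1 - r\<^sup>2) * (3 - r\<^sup>2) / 4"
    by (simp add: field_simps)
  also have "\<dots> \<le> 3 / 4"
    using r2 by simp
  also have "\<dots> = (sqrt 3 / 2)\<^sup>2"
    by (simp add: power_divide)
  finally have "r * sqrt (1 - r\<^sup>2 / 4) \<le> sqrt 3 / 2"
    by (rule power2_le_imp_le) simp
  then show ?thesis using assms(2) by (simp add: distrib_left)
qed

lemma lower_density_ge:
  assumes "lattice_covering F" "contains_two_other_centers F"
  shows "ennreal (2 * pi / (2 + sqrt 3)) \<le> lower_density F"
proof -
  obtain v w where c: "cross v w \<noteq> 0" and F: "F = unit_disk ` lattice_of v w"
    and cov: "\<forall>x. \<exists>q\<in>lattice_of v w. dist q x \<le> 1"
    using assms(1) unfolding lattice_covering_iff by blast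
  have "unit_disk 0 \<in> F" unfolding F by (intro imageI zero_in_lattice)
  from bspec[OF assms(2)[unfolded contains_two_other_centers_def] this]
  obtain u where "unit_disk u \<in> F - {unit_disk 0}" "u \<in> unit_disk 0"
    by (elim exE conjE)
  then have u: "u \<in> lattice_of v w" "u \<noteq> 0" "u \<in> unit_disk 0"
    by (simp_all add: F image_iff)
  then have u1: "norm u \<le> 1" by (simp add: unit_disk_def)
  obtain a b :: int and e where e: "coprime a b" "e = of_int a *\<^sub>R v + of_int b *\<^sub>R w"
    "e \<noteq> 0" "norm e \<le> norm u"
    using primitive_direction[OF u(1,2)] by blast
  have "\<bar>cross v w\<bar> \<le> norm e * (1 + sqrt (1 - (norm e)\<^sup>2 / 4))"
    using covering_row_spacing[OF cov e(1-3)] e(4) u1 by linarith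
  also have "\<dots> \<le> 1 + sqrt 3 / 2"
    using e(4) u1 by (intro row_spacing_maximal) auto
  finally have "pi / (1 + sqrt 3 / 2) \<le> pi / \<bar>cross v w\<bar>"
    using c by (intro divide_left_mono mult_pos_pos) (auto intro: add_pos_nonneg)
  moreover have "2 * pi / (2 + sqrt 3) = pi / (1 + sqrt 3 / 2)"
    by (simp add: field_simps)
  ultimately show ?thesis
    unfolding F lower_density_lattice[OF c] by (intro ennreal_leI) simp
qed

section \<open>An optimal lattice\<close>

text \<open>The lattice in which both estimates above are equalities.\<close>

definition opt_v :: "real^2" where "opt_v = vector [1, 0]"
definition opt_w :: "real^2" where "opt_w = vector [1 / 2, 1 + sqrt 3 / 2]"

lemma cross_opt: "cross opt_v opt_w = 1 + sqrt 3 / 2"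
  by (simp add: cross_def opt_v_def opt_w_def vector_2)

lemma cross_opt_pos: "cross opt_v opt_w > 0"
  unfolding cross_opt by (intro add_pos_nonneg) auto

lemma opt_norm_sq:
  "(norm (s *\<^sub>R opt_v + t *\<^sub>R opt_w))\<^sup>2 = s\<^sup>2 + s * t + (2 + sqrt 3) * t\<^sup>2"
proof -
  have "(norm (s *\<^sub>R opt_v + t *\<^sub>R opt_w))\<^sup>2 = (s + t / 2)\<^sup>2 + (t * (1 + sqrt 3 / 2))\<^sup>2"
    unfolding norm_sq_2 by (simp add: opt_v_def opt_w_def vector_2)
  also have "\<dots> = s\<^sup>2 + s * t + (5 / 4 + sqrt 3 + (sqrt 3 * sqrt 3) / 4) * t\<^sup>2"
    by (simp add: power2_eq_square field_simps del: real_sqrt_mult_self)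
  finally show ?thesis by simp
qed

text \<open>If \<open>p\<close> is the convex combination of the vertices \<open>x\<^sub>i\<close> of a triangle with weights \<open>\<lambda>\<^sub>i\<close>, and \<open>c\<close> and
  \<open>R\<close> are its circumcenter and circumradius, then the average of \<open>|p - x\<^sub>i|^2\<close> with weights \<open>\<lambda>\<^sub>i\<close> is
  \<open>R^2 - |p - c|^2\<close>. This is the case of the triangle with vertices \<open>0\<close>, \<open>opt_v\<close>, \<open>opt_w\<close>, where
  \<open>S = sqrt 3\<close>, \<open>R = 1\<close> and \<open>c = (1/2, S/2)\<close>, and \<open>N\<close> is the squared norm in lattice coordinates.\<close>

lemma triangle_average:
  fixes f g S :: real
  assumes "S * S = 3"
  defines "N \<equiv> \<lambda>s t. s\<^sup>2 + s * t + (2 + S) * t\<^sup>2"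
  shows "(1 - f - g) * N f g + f * N (f - 1) g + g * N f (g - 1)
    = 1 - ((f + g / 2 - 1 / 2)\<^sup>2 + (g * (1 + S / 2) - S / 2)\<^sup>2)"
proof -
  have "(1 - f - g) * N f g + f * N (f - 1) g + g * N f (g - 1)
      - (1 - ((f + g / 2 - 1 / 2)\<^sup>2 + (g * (1 + S / 2) - S / 2)\<^sup>2)) = (S * S - 3) * (1 - g)\<^sup>2 / 4"
    by (simp add: N_def power2_eq_square field_simps)
  then show ?thesis using assms(1) by simp
qed

text \<open>The squared distances to the three vertices have an average of at most 1, so one of them is
  at most 1.\<close>

lemma opt_triangle_covered:
  fixes f g :: real
  assumes "0 \<le> f" "0 \<le> g" "f + g \<le> 1"
  obtains a b :: int where "norm ((f - of_int a) *\<^sub>R opt_v + (g - of_int b) *\<^sub>R opt_w) \<le> 1"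
proof -
  define N where "N a b = (norm ((f - of_int a) *\<^sub>R opt_v + (g - of_int b) *\<^sub>R opt_w))\<^sup>2" for a b :: int
  have "(1 - f - g) * N 0 0 + f * N 1 0 + g * N 0 1
      = 1 - ((f + g / 2 - 1 / 2)\<^sup>2 + (g * (1 + sqrt 3 / 2) - sqrt 3 / 2)\<^sup>2)"
    unfolding N_def opt_norm_sq using triangle_average[of "sqrt 3" f g] by simp
  then have avg: "(1 - f - g) * N 0 0 + f * N 1 0 + g * N 0 1 \<le> 1"
    by (smt (verit) zero_le_power2)
  have "\<exists>a b. N a b \<le> 1"
  proof (rule ccontr)
    assume "\<not> ?thesis"
    then have gt: "N a b > 1" for a b by (meson not_le)
    define \<mu> where "\<mu> = min (N 0 0) (min (N 1 0) (N 0 1))"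
    have "\<mu> > 1" using gt by (simp add: \<mu>_def)
    have "\<mu> = (1 - f - g) * \<mu> + f * \<mu> + g * \<mu>" by (simp add: algebra_simps)
    also have "\<dots> \<le> (1 - f - g) * N 0 0 + f * N 1 0 + g * N 0 1"
      using assms by (intro add_mono mult_left_mono) (auto simp: \<mu>_def)
    finally show False using avg \<open>\<mu> > 1\<close> by simp
  qed
  then show ?thesis
    using that unfolding N_def by (metis abs_norm_cancel abs_square_le_1)
qed

lemma opt_covering: "\<exists>q\<in>lattice_of opt_v opt_w. dist q x \<le> 1"
proof -
  obtain p where p: "p \<in> lattice_of opt_v opt_w" "x - p \<in> fundamental_cell opt_v opt_w"
    using cells_cover_plane[OF less_imp_neq[OF cross_opt_pos, symmetric]] by blast
  obtain f g where fg: "0 \<le> f" "f < 1" "0 \<le> g" "g < 1" "x - p = f *\<^sub>R opt_v + g *\<^sub>R opt_w"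
    using p(2) unfolding cell_iff by blast
  \<comment> \<open>The diagonal from \<open>opt_v\<close> to \<open>opt_w\<close> cuts the cell into two triangles, which the point
    reflection of the cell interchanges.\<close>
  obtain a b :: int where ab: "norm ((f - of_int a) *\<^sub>R opt_v + (g - of_int b) *\<^sub>R opt_w) \<le> 1"
  proof (cases "f + g \<le> 1")
    case True
    then show ?thesis using opt_triangle_covered fg that by blast
  next
    case False
    then obtain a b :: int where
      ab: "norm ((1 - f - of_int a) *\<^sub>R opt_v + (1 - g - of_int b) *\<^sub>R opt_w) \<le> 1"
      using opt_triangle_covered[of "1 - f" "1 - g"] fg by auto
    have "(f - of_int (1 - a)) *\<^sub>R opt_v + (g - of_int (1 - b)) *\<^sub>R opt_w
        = - ((1 - f - of_int a) *\<^sub>R opt_v + (1 - g - of_int b) *\<^sub>R opt_w)"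
      by (simp add: algebra_simps)
    then have "norm ((f - of_int (1 - a)) *\<^sub>R opt_v + (g - of_int (1 - b)) *\<^sub>R opt_w) \<le> 1"
      using ab by (simp only: norm_minus_cancel)
    then show ?thesis using that by blast
  qed
  let ?q = "p + (of_int a *\<^sub>R opt_v + of_int b *\<^sub>R opt_w)"
  have "of_int a *\<^sub>R opt_v + of_int b *\<^sub>R opt_w \<in> lattice_of opt_v opt_w"
    unfolding lattice_of_def by blast
  then have "?q \<in> lattice_of opt_v opt_w" using lattice_add p(1) by blast
  moreover have "x - ?q = (f - of_int a) *\<^sub>R opt_v + (g - of_int b) *\<^sub>R opt_w"
    using fg(5) by (simp add: algebra_simps)
  then have "dist ?q x \<le> 1" using ab by (simp add: dist_norm norm_minus_commute)
  ultimately show ?thesis by blast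
qed

text \<open>Since \<open>norm opt_v = 1\<close>, the disk about \<open>q\<close> has the centers \<open>q + opt_v\<close> and \<open>q - opt_v\<close> on its
  boundary.\<close>

lemma opt_attains:
  fixes F :: "(real^2) set set"
  defines "F \<equiv> unit_disk ` lattice_of opt_v opt_w"
  shows "lattice_covering F" "contains_two_other_centers F"
    "lower_density F = ennreal (2 * pi / (2 + sqrt 3))"
proof -
  have c: "cross opt_v opt_w \<noteq> 0" using cross_opt_pos by simp
  then show "lattice_covering F"
    unfolding lattice_covering_iff F_def using opt_covering by blast
  have "pi / \<bar>cross opt_v opt_w\<bar> = 2 * pi / (2 + sqrt 3)"
    using cross_opt_pos unfolding cross_opt by (simp add: field_simps)
  then show "lower_density F = ennreal (2 * pi / (2 + sqrt 3))"
    unfolding F_def lower_density_lattice[OF c] by simp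
  have nv: "norm opt_v = 1"
    by (simp add: opt_v_def norm_vec_def L2_set_def sum_2 vector_2)
  have v: "of_int k *\<^sub>R opt_v \<in> lattice_of opt_v opt_w" for k
    unfolding lattice_of_def by (rule CollectI, rule exI[of _ k], rule exI[of _ 0]) simp
  show "contains_two_other_centers F"
    unfolding contains_two_other_centers_def
  proof
    fix D assume "D \<in> F"
    then obtain q where q: "q \<in> lattice_of opt_v opt_w" "D = unit_disk q" by (auto simp: F_def)
    have "q + opt_v \<in> lattice_of opt_v opt_w" "q - opt_v \<in> lattice_of opt_v opt_w"
      using lattice_add[OF q(1) v[of 1]] lattice_add[OF q(1) v[of "-1"]] by simp_all
    moreover have v0: "opt_v \<noteq> 0" using nv by auto
    moreover have "q + opt_v \<noteq> q - opt_v"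
    proof
      assume "q + opt_v = q - opt_v"
      then have "2 *\<^sub>R opt_v = 0" by (simp add: scaleR_2)
      with v0 show False by simp
    qed
    moreover have "q + opt_v \<in> D" "q - opt_v \<in> D"
      using nv by (simp_all add: q(2) unit_disk_def dist_norm)
    moreover have "unit_disk (q + opt_v) \<noteq> D" "unit_disk (q - opt_v) \<noteq> D"
      using v0 by (simp_all add: q(2))
    ultimately show "\<exists>p q. p \<noteq> q \<and> unit_disk p \<in> F - {D} \<and> unit_disk q \<in> F - {D} \<and> p \<in> D \<and> q \<in> D"
      unfolding F_def by (metis Diff_iff imageI singletonD)
  qed
qed

theorem theorem1p7:
  "(INF F \<in> {F. lattice_covering F \<and> contains_two_other_centers F}. lower_density F)
     = ennreal (2 * pi / (2 + sqrt 3))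
   \<and> (\<exists>F. lattice_covering F \<and> contains_two_other_centers F
        \<and> lower_density F = ennreal (2 * pi / (2 + sqrt 3)))"
proof (intro conjI antisym)
  let ?F = "unit_disk ` lattice_of opt_v opt_w"
  show "\<exists>F. lattice_covering F \<and> contains_two_other_centers F
        \<and> lower_density F = ennreal (2 * pi / (2 + sqrt 3))"
    using opt_attains by blast
  show "(INF F \<in> {F. lattice_covering F \<and> contains_two_other_centers F}. lower_density F)
      \<le> ennreal (2 * pi / (2 + sqrt 3))"
    using opt_attains by (intro INF_lower2[of ?F]) auto
  show "ennreal (2 * pi / (2 + sqrt 3))
      \<le> (INF F \<in> {F. lattice_covering F \<and> contains_two_other_centers F}. lower_density F)"
    using lower_density_ge by (intro INF_greatest) auto
qed

end
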